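(* If $\Gamma\vdash A_m\dashv\Omega$ is derivable in ordered adjoint natural deduction with explicit structural rules, then $\Omega\vdash A_m$ is derivable in the ordered adjoint sequent calculus.
   Context: Modes and propositions. Fix a preorder $(\mathcal{M},\geq)$ of modes and, for each mode $m$, a set $\sigma(m)\subseteq\{\mathsf{W},\mathsf{C}^\leftarrow,\mathsf{C}^\rightarrow,\mathsf{M}^\leftarrow,\mathsf{M}^\rightarrow\}$, monotone: $k\geq m$ implies $\sigma(k)\supseteq\sigma(m)$. Propositions: $A_m ::= P_m \mid A_m \rightarrowtail B_m \mid A_m \twoheadrightarrow B_m \mid A_m \,\&\, B_m \mid {\uparrow}^m_l A_l\ (m\geq l) \mid A_m\bullet B_m \mid 1_m \mid A_m\oplus B_m \mid {\downarrow}^k_m A_k\ (k\geq m)$. An ordered context $\Omega$ is a finite sequence of labeled hypotheses $x{:}A_m$ (repetitions allowed, each variable always labeling the same proposition); $|\Omega|$ is its set of variables; $\Omega\geq m$ means every $y{:}B_k$ in $\Omega$ has $k\geq m$. Sequent calculus: sequents $\Omega\vdash C_r$ presupposing $\Omega\geq r$; new variables in premises are fresh. Rules (premises $\Rightarrow$ conclusion): (id) $\Rightarrow x{:}A_m\vdash A_m$; (cut) $\Omega_A\vdash A_m$, $\Omega_L(x{:}A_m)\Omega_R\vdash C_r$, $\Omega_A\geq m\geq r\Rightarrow\Omega_L\Omega_A\Omega_R\vdash C_r$; ($1R$) $\Rightarrow\cdot\vdash1_m$; ($1L$) $\Omega_L\Omega_R\vdash C_r\Rightarrow\Omega_L(x{:}1_m)\Omega_R\vdash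 C_r$; ($\bullet R$) $\Omega_1\vdash A_m,\Omega_2\vdash B_m\Rightarrow\Omega_1\Omega_2\vdash A_m\bullet B_m$; ($\bullet L$) $\Omega_L(x_1{:}A_m)(x_2{:}B_m)\Omega_R\vdash C_r\Rightarrow\Omega_L(x{:}A_m\bullet B_m)\Omega_R\vdash C_r$; ($\oplus R_i$) $\Omega\vdash A_m$ (resp. $B_m$) $\Rightarrow\Omega\vdash A_m\oplus B_m$; ($\oplus L$) $\Omega_L(y{:}A_m)\Omega_R\vdash C_r$, $\Omega_L(y{:}B_m)\Omega_R\vdash C_r\Rightarrow\Omega_L(x{:}A_m\oplus B_m)\Omega_R\vdash C_r$; (${\downarrow}R$) $\Omega\vdash A_k$, $\Omega\geq k\Rightarrow\Omega\vdash{\downarrow}^k_mA_k$; (${\downarrow}L$) $\Omega_L(y{:}A_k)\Omega_R\vdash C_r\Rightarrow\Omega_L(x{:}{\downarrow}^k_mA_k)\Omega_R\vdash C_r$; ($\twoheadrightarrow R$) $\Omega(x{:}A_m)\vdash B_m\Rightarrow\Omega\vdash A_m\twoheadrightarrow B_m$; ($\twoheadrightarrow L$) $\Omega_A\vdash A_m$, $\Omega_A\geq m$, $\Omega_L(y{:}B_m)\Omega_R\vdash C_r\Rightarrow\Omega_L(f{:}A_m\twoheadrightarrow B_m)\Omega_A\Omega_R\vdash C_r$; ($\rightarrowtail R$) $(x{:}A_m)\Omega\vdash B_m\Rightarrow\Omega\vdash A_m\rightarrowtail B_m$; ($\rightarrowtail L$) $\Omega_A\vdash A_m$, $\Omega_A\geq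 m$, $\Omega_L(y{:}B_m)\Omega_R\vdash C_r\Rightarrow\Omega_L\Omega_A(f{:}A_m\rightarrowtail B_m)\Omega_R\vdash C_r$; ($\&R$) $\Omega\vdash A_m,\Omega\vdash B_m\Rightarrow\Omega\vdash A_m\&B_m$; ($\&L_i$) $\Omega_L(y{:}A_m)\Omega_R\vdash C_r$ (resp. $B_m$) $\Rightarrow\Omega_L(x{:}A_m\&B_m)\Omega_R\vdash C_r$; (${\uparrow}R$) $\Omega\vdash A_l\Rightarrow\Omega\vdash{\uparrow}^m_lA_l$; (${\uparrow}L$) $\Omega_L(y{:}A_l)\Omega_R\vdash C_r$, $l\geq r\Rightarrow\Omega_L(x{:}{\uparrow}^m_lA_l)\Omega_R\vdash C_r$; structural rules ($\mathsf{M}^\leftarrow$) $\Omega_L\Omega_M(x{:}A_m)\Omega_R\vdash C_r\Rightarrow\Omega_L(x{:}A_m)\Omega_M\Omega_R\vdash C_r$ if $\mathsf{M}^\leftarrow\in\sigma(m)$; ($\mathsf{M}^\rightarrow$) $\Omega_L(x{:}A_m)\Omega_M\Omega_R\vdash C_r\Rightarrow\Omega_L\Omega_M(x{:}A_m)\Omega_R\vdash C_r$ if $\mathsf{M}^\rightarrow\in\sigma(m)$; ($\mathsf{C}^\leftarrow$) $\Omega_L(x{:}A_m)\Omega_M(x{:}A_m)\Omega_R\vdash C_r\Rightarrow\Omega_L(x{:}A_m)\Omega_M\Omega_R\vdash C_r$ if $\mathsf{C}^\leftarrow\in\sigma(m)$; ($\mathsf{C}^\rightarrow$) same premise $\Rightarrow\Omega_L\Omega_M(x{:}A_m)\Omega_R\vdash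 C_r$ if $\mathsf{C}^\rightarrow\in\sigma(m)$; ($\mathsf{W}$) $\Omega_L\Omega_R\vdash C_r\Rightarrow\Omega_L(x{:}A_m)\Omega_R\vdash C_r$ if $\mathsf{W}\in\sigma(m)$. Natural deduction with explicit structural rules: judgment $\Gamma\vdash A_m\dashv\Omega$, $\Gamma$ an unordered set of labeled hypotheses, $\Omega$ the ordered context of used hypotheses. Rules: (hyp) $x{:}A_m\in\Gamma\Rightarrow\Gamma\vdash A_m\dashv(x{:}A_m)$; ($1I$) $\Rightarrow\Gamma\vdash1_m\dashv\cdot$; ($1E$) $\Gamma\vdash1_m\dashv\Omega_M$, $m\geq r$, $\Gamma\vdash C_r\dashv\Omega_L\Omega_R\Rightarrow\Gamma\vdash C_r\dashv\Omega_L\Omega_M\Omega_R$; ($\bullet I$) $\Gamma\vdash A_m\dashv\Omega_L,\Gamma\vdash B_m\dashv\Omega_R\Rightarrow\Gamma\vdash A_m\bullet B_m\dashv\Omega_L\Omega_R$; ($\bullet E$) $\Gamma\vdash A_m\bullet B_m\dashv\Omega_M$, $m\geq r$, $x,y\notin|\Omega_L\Omega_R|$, $\Gamma,x{:}A_m,y{:}B_m\vdash C_r\dashv\Omega_L(x{:}A_m)(y{:}B_m)\Omega_R\Rightarrow\Gamma\vdash C_r\dashv\Omega_L\Omega_M\Omega_R$; ($\oplus I_i$) $\Gamma\vdash A_m\dashv\Omega$ (resp. $B_m$) $\Rightarrow\Gamma\vdash A_m\oplus B_m\dashv\Omega$; ($\oplus E$) $\Gamma\vdash A_m\oplus B_m\dashv\Omega_M$,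 $m\geq r$, $x\notin|\Omega_L\Omega_R|$, $\Gamma,x{:}A_m\vdash C_r\dashv\Omega_L(x{:}A_m)\Omega_R$, $\Gamma,x{:}B_m\vdash C_r\dashv\Omega_L(x{:}B_m)\Omega_R\Rightarrow\Gamma\vdash C_r\dashv\Omega_L\Omega_M\Omega_R$; (${\downarrow}I$) $\Gamma\vdash A_k\dashv\Omega\Rightarrow\Gamma\vdash{\downarrow}^k_mA_k\dashv\Omega$; (${\downarrow}E$) $\Gamma\vdash{\downarrow}^k_mA_k\dashv\Omega_M$, $m\geq r$, $\Gamma,x{:}A_k\vdash C_r\dashv\Omega_L(x{:}A_k)\Omega_R$, $x\notin|\Omega_L\Omega_R|\Rightarrow\Gamma\vdash C_r\dashv\Omega_L\Omega_M\Omega_R$; ($\twoheadrightarrow I$) $\Gamma,x{:}A_m\vdash B_m\dashv\Omega(x{:}A_m)$, $x\notin|\Omega|\Rightarrow\Gamma\vdash A_m\twoheadrightarrow B_m\dashv\Omega$; ($\twoheadrightarrow E$) $\Gamma\vdash A_m\twoheadrightarrow B_m\dashv\Omega_L,\Gamma\vdash A_m\dashv\Omega_R\Rightarrow\Gamma\vdash B_m\dashv\Omega_L\Omega_R$; ($\rightarrowtail I$) $\Gamma,x{:}A_m\vdash B_m\dashv(x{:}A_m)\Omega$, $x\notin|\Omega|\Rightarrow\Gamma\vdash A_m\rightarrowtail B_m\dashv\Omega$; ($\rightarrowtail E$) $\Gamma\vdash A_m\rightarrowtail B_m\dashv\Omega_R,\Gamma\vdash A_m\dashv\Omega_L\Rightarrow\Gamma\vdash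 B_m\dashv\Omega_L\Omega_R$; ($\&I$) $\Gamma\vdash A_m\dashv\Omega,\Gamma\vdash B_m\dashv\Omega\Rightarrow\Gamma\vdash A_m\&B_m\dashv\Omega$; ($\&E_i$) $\Gamma\vdash A_m\&B_m\dashv\Omega\Rightarrow\Gamma\vdash A_m\dashv\Omega$ (resp. $B_m$); (${\uparrow}I$) $\Gamma\vdash A_l\dashv\Omega$, $\Omega\geq m\Rightarrow\Gamma\vdash{\uparrow}^m_lA_l\dashv\Omega$; (${\uparrow}E$) $\Gamma\vdash{\uparrow}^l_kA_k\dashv\Omega\Rightarrow\Gamma\vdash A_k\dashv\Omega$; structural: ($\mathsf{W}$) $\Gamma\vdash C_r\dashv\Omega_L\Omega_R$, $x{:}A_m\in\Gamma$, $m\geq r$, $\mathsf{W}\in\sigma(m)\Rightarrow\Gamma\vdash C_r\dashv\Omega_L(x{:}A_m)\Omega_R$; ($\mathsf{C}^\rightarrow$) $\Gamma\vdash C_r\dashv\Omega_L(x{:}A_m)\Omega_M(x{:}A_m)\Omega_R$, $\mathsf{C}^\rightarrow\in\sigma(m)\Rightarrow\Gamma\vdash C_r\dashv\Omega_L\Omega_M(x{:}A_m)\Omega_R$; ($\mathsf{C}^\leftarrow$) same premise, $\mathsf{C}^\leftarrow\in\sigma(m)\Rightarrow\Gamma\vdash C_r\dashv\Omega_L(x{:}A_m)\Omega_M\Omega_R$; ($\mathsf{M}^\rightarrow$) $\Gamma\vdash C_r\dashv\Omega_L(x{:}A_m)\Omega_M\Omega_R$, $\mathsf{M}^\rightarrow\in\sigma(m)\Rightarrow\Gamma\vdash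 C_r\dashv\Omega_L\Omega_M(x{:}A_m)\Omega_R$; ($\mathsf{M}^\leftarrow$) $\Gamma\vdash C_r\dashv\Omega_L\Omega_M(x{:}A_m)\Omega_R$, $\mathsf{M}^\leftarrow\in\sigma(m)\Rightarrow\Gamma\vdash C_r\dashv\Omega_L(x{:}A_m)\Omega_M\Omega_R$. *)

theory Defs
  imports Main
begin

datatype structural =
    Weakening
  | ContractionL  \<comment> \<open>\<open>C\<^sup>\<leftarrow>\<close>: keeps the left one of two occurrences\<close>
  | ContractionR  \<comment> \<open>\<open>C\<^sup>\<rightarrow>\<close>: keeps the right one of two occurrences\<close>
  | MobilityL     \<comment> \<open>\<open>M\<^sup>\<leftarrow>\<close>\<close>
  | MobilityR     \<comment> \<open>\<open>M\<^sup>\<rightarrow>\<close>\<close>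

text \<open>
  Raw propositions over atoms \<open>'a\<close> and modes \<open>'m\<close>; \<^term>\<open>wf_prop\<close> below selects the
  well-moded ones. Both implications are written with their antecedent first:
  \<open>ImpL A B\<close> takes its argument from the left of the context (the arrow with a tail),
  \<open>ImpR A B\<close> from the right (the two-headed arrow). A shift stores only its target mode;
  the source mode is the mode of its argument.
\<close>

datatype ('a, 'm) mprop =
    Atom 'm 'a
  | ImpL "('a, 'm) mprop" "('a, 'm) mprop"
  | ImpR "('a, 'm) mprop" "('a, 'm) mprop"
  | With "('a, 'm) mprop" "('a, 'm) mprop"
  | Up 'm "('a, 'm) mprop"
  | Fuse "('a, 'm) mprop" "('a, 'm) mprop"
  | One 'm
  | Plus "('a, 'm) mprop" "('a, 'm) mprop"
  | Down 'm "('a, 'm) mprop"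

primrec mode :: "('a, 'm) mprop \<Rightarrow> 'm" where
  "mode (Atom m P) = m"
| "mode (ImpL A B) = mode A"
| "mode (ImpR A B) = mode A"
| "mode (With A B) = mode A"
| "mode (Up m A) = m"
| "mode (Fuse A B) = mode A"
| "mode (One m) = m"
| "mode (Plus A B) = mode A"
| "mode (Down m A) = m"

primrec wf_prop :: "('a, 'm::preorder) mprop \<Rightarrow> bool" where
  "wf_prop (Atom m P) \<longleftrightarrow> True"
| "wf_prop (ImpL A B) \<longleftrightarrow> wf_prop A \<and> wf_prop B \<and> mode A = mode B"
| "wf_prop (ImpR A B) \<longleftrightarrow> wf_prop A \<and> wf_prop B \<and> mode A = mode B"
| "wf_prop (With A B) \<longleftrightarrow> wf_prop A \<and> wf_prop B \<and> mode A = mode B"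
| "wf_prop (Up m A) \<longleftrightarrow> wf_prop A \<and> m \<ge> mode A"
| "wf_prop (Fuse A B) \<longleftrightarrow> wf_prop A \<and> wf_prop B \<and> mode A = mode B"
| "wf_prop (One m) \<longleftrightarrow> True"
| "wf_prop (Plus A B) \<longleftrightarrow> wf_prop A \<and> wf_prop B \<and> mode A = mode B"
| "wf_prop (Down m A) \<longleftrightarrow> wf_prop A \<and> mode A \<ge> m"

type_synonym var = nat
type_synonym ('a, 'm) hyp = "var \<times> ('a, 'm) mprop"
type_synonym ('a, 'm) octx = "('a, 'm) hyp list"

definition vars :: "('a, 'm) octx \<Rightarrow> var set" where
  "vars \<Omega> = fst ` set \<Omega>"

definition octx_ge :: "('a, 'm::preorder) octx \<Rightarrow> 'm \<Rightarrow> bool" where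
  "octx_ge \<Omega> m \<longleftrightarrow> (\<forall>(y, B) \<in> set \<Omega>. mode B \<ge> m)"

text \<open>Each variable labels a single proposition, and all propositions are well-moded.\<close>

definition wf_hyps :: "('a, 'm::preorder) hyp set \<Rightarrow> bool" where
  "wf_hyps \<Gamma> \<longleftrightarrow> single_valued \<Gamma> \<and> (\<forall>(x, A) \<in> \<Gamma>. wf_prop A)"

definition wf_sequent :: "('a, 'm::preorder) octx \<Rightarrow> ('a, 'm) mprop \<Rightarrow> bool" where
  "wf_sequent \<Omega> C \<longleftrightarrow> wf_hyps (set \<Omega>) \<and> wf_prop C \<and> octx_ge \<Omega> (mode C)"

definition wf_goal :: "('a, 'm::preorder) hyp set \<Rightarrow> ('a, 'm) mprop \<Rightarrow> bool" where
  "wf_goal \<Gamma> C \<longleftrightarrow> wf_hyps \<Gamma> \<and> wf_prop C"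

text \<open>
  \<open>sequent \<sigma> \<Omega> C\<close>: derivability in the sequent calculus. Every rule requires its conclusion to
  satisfy the presupposition \<^term>\<open>wf_sequent\<close> (which is automatic for \<open>OneR\<close>); its premises
  then satisfy it as well, since they are derivable themselves. Variables that are new in a
  premise must not occur in the conclusion.
\<close>

inductive sequent ::
    "('m::preorder \<Rightarrow> structural set) \<Rightarrow> ('a, 'm) octx \<Rightarrow> ('a, 'm) mprop \<Rightarrow> bool"
  for \<sigma> :: "'m \<Rightarrow> structural set" where
  Id: "wf_sequent [(x, A)] A \<Longrightarrow> sequent \<sigma> [(x, A)] A"
| Cut: "\<lbrakk>sequent \<sigma> \<Omega>A A; sequent \<sigma> (\<Omega>L @ [(x, A)] @ \<Omega>R) C;
         octx_ge \<Omega>A (mode A); mode A \<ge> mode C;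
         x \<notin> vars (\<Omega>L @ \<Omega>A @ \<Omega>R); wf_sequent (\<Omega>L @ \<Omega>A @ \<Omega>R) C\<rbrakk>
        \<Longrightarrow> sequent \<sigma> (\<Omega>L @ \<Omega>A @ \<Omega>R) C"
| OneR: "sequent \<sigma> [] (One m)"
| OneL: "\<lbrakk>sequent \<sigma> (\<Omega>L @ \<Omega>R) C; wf_sequent (\<Omega>L @ [(x, One m)] @ \<Omega>R) C\<rbrakk>
        \<Longrightarrow> sequent \<sigma> (\<Omega>L @ [(x, One m)] @ \<Omega>R) C"
| FuseR: "\<lbrakk>sequent \<sigma> \<Omega>1 A; sequent \<sigma> \<Omega>2 B; wf_sequent (\<Omega>1 @ \<Omega>2) (Fuse A B)\<rbrakk>
        \<Longrightarrow> sequent \<sigma> (\<Omega>1 @ \<Omega>2) (Fuse A B)"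
| FuseL: "\<lbrakk>sequent \<sigma> (\<Omega>L @ [(x1, A), (x2, B)] @ \<Omega>R) C; x1 \<noteq> x2;
         x1 \<notin> vars (\<Omega>L @ [(x, Fuse A B)] @ \<Omega>R); x2 \<notin> vars (\<Omega>L @ [(x, Fuse A B)] @ \<Omega>R);
         wf_sequent (\<Omega>L @ [(x, Fuse A B)] @ \<Omega>R) C\<rbrakk>
        \<Longrightarrow> sequent \<sigma> (\<Omega>L @ [(x, Fuse A B)] @ \<Omega>R) C"
| PlusR1: "\<lbrakk>sequent \<sigma> \<Omega> A; wf_sequent \<Omega> (Plus A B)\<rbrakk> \<Longrightarrow> sequent \<sigma> \<Omega> (Plus A B)"
| PlusR2: "\<lbrakk>sequent \<sigma> \<Omega> B; wf_sequent \<Omega> (Plus A B)\<rbrakk> \<Longrightarrow> sequent \<sigma> \<Omega> (Plus A B)"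
| PlusL: "\<lbrakk>sequent \<sigma> (\<Omega>L @ [(y, A)] @ \<Omega>R) C; sequent \<sigma> (\<Omega>L @ [(y, B)] @ \<Omega>R) C;
         y \<notin> vars (\<Omega>L @ [(x, Plus A B)] @ \<Omega>R);
         wf_sequent (\<Omega>L @ [(x, Plus A B)] @ \<Omega>R) C\<rbrakk>
        \<Longrightarrow> sequent \<sigma> (\<Omega>L @ [(x, Plus A B)] @ \<Omega>R) C"
| DownR: "\<lbrakk>sequent \<sigma> \<Omega> A; octx_ge \<Omega> (mode A); wf_sequent \<Omega> (Down m A)\<rbrakk>
        \<Longrightarrow> sequent \<sigma> \<Omega> (Down m A)"
| DownL: "\<lbrakk>sequent \<sigma> (\<Omega>L @ [(y, A)] @ \<Omega>R) C; y \<notin> vars (\<Omega>L @ [(x, Down m A)] @ \<Omega>R);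
         wf_sequent (\<Omega>L @ [(x, Down m A)] @ \<Omega>R) C\<rbrakk>
        \<Longrightarrow> sequent \<sigma> (\<Omega>L @ [(x, Down m A)] @ \<Omega>R) C"
| ImpRR: "\<lbrakk>sequent \<sigma> (\<Omega> @ [(x, A)]) B; x \<notin> vars \<Omega>; wf_sequent \<Omega> (ImpR A B)\<rbrakk>
        \<Longrightarrow> sequent \<sigma> \<Omega> (ImpR A B)"
| ImpRL: "\<lbrakk>sequent \<sigma> \<Omega>A A; octx_ge \<Omega>A (mode A); sequent \<sigma> (\<Omega>L @ [(y, B)] @ \<Omega>R) C;
         y \<notin> vars (\<Omega>L @ [(f, ImpR A B)] @ \<Omega>A @ \<Omega>R);
         wf_sequent (\<Omega>L @ [(f, ImpR A B)] @ \<Omega>A @ \<Omega>R) C\<rbrakk>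
        \<Longrightarrow> sequent \<sigma> (\<Omega>L @ [(f, ImpR A B)] @ \<Omega>A @ \<Omega>R) C"
| ImpLR: "\<lbrakk>sequent \<sigma> ([(x, A)] @ \<Omega>) B; x \<notin> vars \<Omega>; wf_sequent \<Omega> (ImpL A B)\<rbrakk>
        \<Longrightarrow> sequent \<sigma> \<Omega> (ImpL A B)"
| ImpLL: "\<lbrakk>sequent \<sigma> \<Omega>A A; octx_ge \<Omega>A (mode A); sequent \<sigma> (\<Omega>L @ [(y, B)] @ \<Omega>R) C;
         y \<notin> vars (\<Omega>L @ \<Omega>A @ [(f, ImpL A B)] @ \<Omega>R);
         wf_sequent (\<Omega>L @ \<Omega>A @ [(f, ImpL A B)] @ \<Omega>R) C\<rbrakk>
        \<Longrightarrow> sequent \<sigma> (\<Omega>L @ \<Omega>A @ [(f, ImpL A B)] @ \<Omega>R) C"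
| WithR: "\<lbrakk>sequent \<sigma> \<Omega> A; sequent \<sigma> \<Omega> B; wf_sequent \<Omega> (With A B)\<rbrakk>
        \<Longrightarrow> sequent \<sigma> \<Omega> (With A B)"
| WithL1: "\<lbrakk>sequent \<sigma> (\<Omega>L @ [(y, A)] @ \<Omega>R) C; y \<notin> vars (\<Omega>L @ [(x, With A B)] @ \<Omega>R);
         wf_sequent (\<Omega>L @ [(x, With A B)] @ \<Omega>R) C\<rbrakk>
        \<Longrightarrow> sequent \<sigma> (\<Omega>L @ [(x, With A B)] @ \<Omega>R) C"
| WithL2: "\<lbrakk>sequent \<sigma> (\<Omega>L @ [(y, B)] @ \<Omega>R) C; y \<notin> vars (\<Omega>L @ [(x, With A B)] @ \<Omega>R);
         wf_sequent (\<Omega>L @ [(x, With A B)] @ \<Omega>R) C\<rbrakk>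
        \<Longrightarrow> sequent \<sigma> (\<Omega>L @ [(x, With A B)] @ \<Omega>R) C"
| UpR: "\<lbrakk>sequent \<sigma> \<Omega> A; wf_sequent \<Omega> (Up m A)\<rbrakk> \<Longrightarrow> sequent \<sigma> \<Omega> (Up m A)"
| UpL: "\<lbrakk>sequent \<sigma> (\<Omega>L @ [(y, A)] @ \<Omega>R) C; mode A \<ge> mode C;
         y \<notin> vars (\<Omega>L @ [(x, Up m A)] @ \<Omega>R);
         wf_sequent (\<Omega>L @ [(x, Up m A)] @ \<Omega>R) C\<rbrakk>
        \<Longrightarrow> sequent \<sigma> (\<Omega>L @ [(x, Up m A)] @ \<Omega>R) C"
| MobL: "\<lbrakk>sequent \<sigma> (\<Omega>L @ \<Omega>M @ [(x, A)] @ \<Omega>R) C; MobilityL \<in> \<sigma> (mode A);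
         wf_sequent (\<Omega>L @ [(x, A)] @ \<Omega>M @ \<Omega>R) C\<rbrakk>
        \<Longrightarrow> sequent \<sigma> (\<Omega>L @ [(x, A)] @ \<Omega>M @ \<Omega>R) C"
| MobR: "\<lbrakk>sequent \<sigma> (\<Omega>L @ [(x, A)] @ \<Omega>M @ \<Omega>R) C; MobilityR \<in> \<sigma> (mode A);
         wf_sequent (\<Omega>L @ \<Omega>M @ [(x, A)] @ \<Omega>R) C\<rbrakk>
        \<Longrightarrow> sequent \<sigma> (\<Omega>L @ \<Omega>M @ [(x, A)] @ \<Omega>R) C"
| ContrL: "\<lbrakk>sequent \<sigma> (\<Omega>L @ [(x, A)] @ \<Omega>M @ [(x, A)] @ \<Omega>R) C; ContractionL \<in> \<sigma> (mode A);
         wf_sequent (\<Omega>L @ [(x, A)] @ \<Omega>M @ \<Omega>R) C\<rbrakk>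
        \<Longrightarrow> sequent \<sigma> (\<Omega>L @ [(x, A)] @ \<Omega>M @ \<Omega>R) C"
| ContrR: "\<lbrakk>sequent \<sigma> (\<Omega>L @ [(x, A)] @ \<Omega>M @ [(x, A)] @ \<Omega>R) C; ContractionR \<in> \<sigma> (mode A);
         wf_sequent (\<Omega>L @ \<Omega>M @ [(x, A)] @ \<Omega>R) C\<rbrakk>
        \<Longrightarrow> sequent \<sigma> (\<Omega>L @ \<Omega>M @ [(x, A)] @ \<Omega>R) C"
| Weak: "\<lbrakk>sequent \<sigma> (\<Omega>L @ \<Omega>R) C; Weakening \<in> \<sigma> (mode A);
         wf_sequent (\<Omega>L @ [(x, A)] @ \<Omega>R) C\<rbrakk>
        \<Longrightarrow> sequent \<sigma> (\<Omega>L @ [(x, A)] @ \<Omega>R) C"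

text \<open>
  \<open>natded \<sigma> \<Gamma> C \<Omega>\<close>: derivability in natural deduction with explicit structural rules, where
  \<open>\<Omega>\<close> is the output context of used hypotheses. Extending \<open>\<Gamma>\<close> by a hypothesis is subject to
  \<^term>\<open>wf_hyps\<close> only: a variable already in \<open>\<Gamma>\<close> may be reused with the same proposition, as
  long as the side conditions on \<open>\<Omega>\<close> hold. This admits at least the derivations that always
  choose variables outside \<open>\<Gamma>\<close>. That \<open>\<Omega>\<close> is drawn from \<open>\<Gamma>\<close> and that \<open>octx_ge \<Omega> (mode C)\<close>
  holds are consequences of the rules and hence not imposed.
\<close>

inductive natded ::
    "('m::preorder \<Rightarrow> structural set) \<Rightarrow> ('a, 'm) hyp set \<Rightarrow> ('a, 'm) mprop \<Rightarrow> ('a, 'm) octx \<Rightarrow> bool"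
  for \<sigma> :: "'m \<Rightarrow> structural set" where
  Hyp: "\<lbrakk>(x, A) \<in> \<Gamma>; wf_goal \<Gamma> A\<rbrakk> \<Longrightarrow> natded \<sigma> \<Gamma> A [(x, A)]"
| OneI: "wf_goal \<Gamma> (One m) \<Longrightarrow> natded \<sigma> \<Gamma> (One m) []"
| OneE: "\<lbrakk>natded \<sigma> \<Gamma> (One m) \<Omega>M; m \<ge> mode C; natded \<sigma> \<Gamma> C (\<Omega>L @ \<Omega>R)\<rbrakk>
        \<Longrightarrow> natded \<sigma> \<Gamma> C (\<Omega>L @ \<Omega>M @ \<Omega>R)"
| FuseI: "\<lbrakk>natded \<sigma> \<Gamma> A \<Omega>L; natded \<sigma> \<Gamma> B \<Omega>R; wf_goal \<Gamma> (Fuse A B)\<rbrakk>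
        \<Longrightarrow> natded \<sigma> \<Gamma> (Fuse A B) (\<Omega>L @ \<Omega>R)"
| FuseE: "\<lbrakk>natded \<sigma> \<Gamma> (Fuse A B) \<Omega>M; mode (Fuse A B) \<ge> mode C;
         x \<noteq> y; x \<notin> vars (\<Omega>L @ \<Omega>R); y \<notin> vars (\<Omega>L @ \<Omega>R);
         natded \<sigma> (insert (y, B) (insert (x, A) \<Gamma>)) C (\<Omega>L @ [(x, A), (y, B)] @ \<Omega>R)\<rbrakk>
        \<Longrightarrow> natded \<sigma> \<Gamma> C (\<Omega>L @ \<Omega>M @ \<Omega>R)"
| PlusI1: "\<lbrakk>natded \<sigma> \<Gamma> A \<Omega>; wf_goal \<Gamma> (Plus A B)\<rbrakk> \<Longrightarrow> natded \<sigma> \<Gamma> (Plus A B) \<Omega>"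
| PlusI2: "\<lbrakk>natded \<sigma> \<Gamma> B \<Omega>; wf_goal \<Gamma> (Plus A B)\<rbrakk> \<Longrightarrow> natded \<sigma> \<Gamma> (Plus A B) \<Omega>"
| PlusE: "\<lbrakk>natded \<sigma> \<Gamma> (Plus A B) \<Omega>M; mode (Plus A B) \<ge> mode C; x \<notin> vars (\<Omega>L @ \<Omega>R);
         natded \<sigma> (insert (x, A) \<Gamma>) C (\<Omega>L @ [(x, A)] @ \<Omega>R);
         natded \<sigma> (insert (x, B) \<Gamma>) C (\<Omega>L @ [(x, B)] @ \<Omega>R)\<rbrakk>
        \<Longrightarrow> natded \<sigma> \<Gamma> C (\<Omega>L @ \<Omega>M @ \<Omega>R)"
| DownI: "\<lbrakk>natded \<sigma> \<Gamma> A \<Omega>; wf_goal \<Gamma> (Down m A)\<rbrakk> \<Longrightarrow> natded \<sigma> \<Gamma> (Down m A) \<Omega>"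
| DownE: "\<lbrakk>natded \<sigma> \<Gamma> (Down m A) \<Omega>M; m \<ge> mode C;
         natded \<sigma> (insert (x, A) \<Gamma>) C (\<Omega>L @ [(x, A)] @ \<Omega>R); x \<notin> vars (\<Omega>L @ \<Omega>R)\<rbrakk>
        \<Longrightarrow> natded \<sigma> \<Gamma> C (\<Omega>L @ \<Omega>M @ \<Omega>R)"
| ImpRI: "\<lbrakk>natded \<sigma> (insert (x, A) \<Gamma>) B (\<Omega> @ [(x, A)]); x \<notin> vars \<Omega>; wf_goal \<Gamma> (ImpR A B)\<rbrakk>
        \<Longrightarrow> natded \<sigma> \<Gamma> (ImpR A B) \<Omega>"
| ImpRE: "\<lbrakk>natded \<sigma> \<Gamma> (ImpR A B) \<Omega>L; natded \<sigma> \<Gamma> A \<Omega>R\<rbrakk> \<Longrightarrow> natded \<sigma> \<Gamma> B (\<Omega>L @ \<Omega>R)"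
| ImpLI: "\<lbrakk>natded \<sigma> (insert (x, A) \<Gamma>) B ([(x, A)] @ \<Omega>); x \<notin> vars \<Omega>; wf_goal \<Gamma> (ImpL A B)\<rbrakk>
        \<Longrightarrow> natded \<sigma> \<Gamma> (ImpL A B) \<Omega>"
| ImpLE: "\<lbrakk>natded \<sigma> \<Gamma> (ImpL A B) \<Omega>R; natded \<sigma> \<Gamma> A \<Omega>L\<rbrakk> \<Longrightarrow> natded \<sigma> \<Gamma> B (\<Omega>L @ \<Omega>R)"
| WithI: "\<lbrakk>natded \<sigma> \<Gamma> A \<Omega>; natded \<sigma> \<Gamma> B \<Omega>; wf_goal \<Gamma> (With A B)\<rbrakk>
        \<Longrightarrow> natded \<sigma> \<Gamma> (With A B) \<Omega>"
| WithE1: "natded \<sigma> \<Gamma> (With A B) \<Omega> \<Longrightarrow> natded \<sigma> \<Gamma> A \<Omega>"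
| WithE2: "natded \<sigma> \<Gamma> (With A B) \<Omega> \<Longrightarrow> natded \<sigma> \<Gamma> B \<Omega>"
| UpI: "\<lbrakk>natded \<sigma> \<Gamma> A \<Omega>; octx_ge \<Omega> m; wf_goal \<Gamma> (Up m A)\<rbrakk> \<Longrightarrow> natded \<sigma> \<Gamma> (Up m A) \<Omega>"
| UpE: "natded \<sigma> \<Gamma> (Up l A) \<Omega> \<Longrightarrow> natded \<sigma> \<Gamma> A \<Omega>"
| NWeak: "\<lbrakk>natded \<sigma> \<Gamma> C (\<Omega>L @ \<Omega>R); (x, A) \<in> \<Gamma>; mode A \<ge> mode C; Weakening \<in> \<sigma> (mode A)\<rbrakk>
        \<Longrightarrow> natded \<sigma> \<Gamma> C (\<Omega>L @ [(x, A)] @ \<Omega>R)"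
| NContrR: "\<lbrakk>natded \<sigma> \<Gamma> C (\<Omega>L @ [(x, A)] @ \<Omega>M @ [(x, A)] @ \<Omega>R); ContractionR \<in> \<sigma> (mode A)\<rbrakk>
        \<Longrightarrow> natded \<sigma> \<Gamma> C (\<Omega>L @ \<Omega>M @ [(x, A)] @ \<Omega>R)"
| NContrL: "\<lbrakk>natded \<sigma> \<Gamma> C (\<Omega>L @ [(x, A)] @ \<Omega>M @ [(x, A)] @ \<Omega>R); ContractionL \<in> \<sigma> (mode A)\<rbrakk>
        \<Longrightarrow> natded \<sigma> \<Gamma> C (\<Omega>L @ [(x, A)] @ \<Omega>M @ \<Omega>R)"
| NMobR: "\<lbrakk>natded \<sigma> \<Gamma> C (\<Omega>L @ [(x, A)] @ \<Omega>M @ \<Omega>R); MobilityR \<in> \<sigma> (mode A)\<rbrakk>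
        \<Longrightarrow> natded \<sigma> \<Gamma> C (\<Omega>L @ \<Omega>M @ [(x, A)] @ \<Omega>R)"
| NMobL: "\<lbrakk>natded \<sigma> \<Gamma> C (\<Omega>L @ \<Omega>M @ [(x, A)] @ \<Omega>R); MobilityL \<in> \<sigma> (mode A)\<rbrakk>
        \<Longrightarrow> natded \<sigma> \<Gamma> C (\<Omega>L @ [(x, A)] @ \<Omega>M @ \<Omega>R)"

end

theory Submission
  imports Defs
begin

text \<open>
  Introduction and structural rules translate to the corresponding right and structural rules.
  An elimination rule becomes the corresponding left rule on a fresh variable standing for the
  major premise, followed by a cut. Choosing the cut variable fresh for all contexts matters since
  a variable bound by an elimination may occur in the context of its major premise.
\<close>

lemma vars_simps [simp]:
  "vars [] = {}" "vars (h # \<Omega>) = insert (fst h) (vars \<Omega>)" "vars (\<Omega> @ \<Omega>') = vars \<Omega> \<union> vars \<Omega>'"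
  by (auto simp: vars_def)

lemma finite_vars [simp]: "finite (vars \<Omega>)"
  by (simp add: vars_def)

lemma octx_ge_simps [simp]:
  "octx_ge [] m" "octx_ge (h # \<Omega>) m \<longleftrightarrow> mode (snd h) \<ge> m \<and> octx_ge \<Omega> m"
  "octx_ge (\<Omega> @ \<Omega>') m \<longleftrightarrow> octx_ge \<Omega> m \<and> octx_ge \<Omega>' m"
  by (auto simp: octx_ge_def)

lemma octx_ge_trans: "octx_ge \<Omega> k \<Longrightarrow> k \<ge> m \<Longrightarrow> octx_ge \<Omega> m"
  by (induction \<Omega>) (auto dest: order_trans[of m k])

lemma wf_hyps_subset: "wf_hyps \<Gamma> \<Longrightarrow> \<Delta> \<subseteq> \<Gamma> \<Longrightarrow> wf_hyps \<Delta>"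
  using single_valued_subset[of \<Delta> \<Gamma>] by (auto simp: wf_hyps_def)

lemma notin_vars: "x \<notin> vars \<Omega> \<Longrightarrow> (x, A) \<notin> set \<Omega>"
  by (auto simp: vars_def image_iff)

lemma wf_hyps_insert_fresh:
  "wf_hyps (set \<Omega>) \<Longrightarrow> x \<notin> vars \<Omega> \<Longrightarrow> wf_prop A \<Longrightarrow> wf_hyps (insert (x, A) (set \<Omega>))"
  by (simp add: wf_hyps_def single_valued_def notin_vars)

text \<open>Serves the rules that discharge a hypothesis: their side condition on the output context
  keeps the entry \<open>(x, A)\<close> out of what remains, so the remainder already comes from
  \<open>\<Gamma>\<close>.\<close>

lemma subset_insert_fresh: "set \<Omega> \<subseteq> insert (x, A) \<Gamma> \<Longrightarrow> x \<notin> vars \<Omega> \<Longrightarrow> set \<Omega> \<subseteq> \<Gamma>"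
  by (simp add: notin_vars subset_insert)

text \<open>Recovers by rule induction the presuppositions that \<open>natded\<close> leaves
  implicit. In an elimination, the context of the major premise is bounded by the mode of the
  eliminated proposition, and transitivity carries that bound down to the mode of the
  conclusion.\<close>

lemma natded_wf:
  assumes "natded \<sigma> \<Gamma> C \<Omega>"
  shows "wf_goal \<Gamma> C \<and> set \<Omega> \<subseteq> \<Gamma> \<and> octx_ge \<Omega> (mode C)"
  using assms
proof induction
  case (FuseE \<Gamma> A B \<Omega>M C x y \<Omega>L \<Omega>R)
  then have "set (\<Omega>L @ \<Omega>R) \<subseteq> \<Gamma>"
    \<comment> \<open>The discharged hypotheses are removed one after the other, \<open>y\<close>
      first since it is inserted last.\<close>
    by - (rule subset_insert_fresh[of _ x A, OF subset_insert_fresh[of _ y B]], auto)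
  with FuseE show ?case
    using octx_ge_trans[of \<Omega>M "mode A" "mode C"] by (auto simp: wf_goal_def)
next
  case (PlusE \<Gamma> A B \<Omega>M C x \<Omega>L \<Omega>R)
  then have "set (\<Omega>L @ \<Omega>R) \<subseteq> \<Gamma>"
    by - (rule subset_insert_fresh[of _ x A], auto)
  with PlusE show ?case
    using octx_ge_trans[of \<Omega>M "mode A" "mode C"] by (auto simp: wf_goal_def)
next
  case (DownE \<Gamma> m A \<Omega>M C x \<Omega>L \<Omega>R)
  then have "set (\<Omega>L @ \<Omega>R) \<subseteq> \<Gamma>"
    by - (rule subset_insert_fresh[of _ x A], auto)
  with DownE show ?case
    using octx_ge_trans[of \<Omega>M m "mode C"] by (auto simp: wf_goal_def)
next
  case (ImpRI x A \<Gamma> B \<Omega>)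
  then have "set \<Omega> \<subseteq> \<Gamma>"
    by - (rule subset_insert_fresh[of _ x A], auto)
  with ImpRI show ?case
    by (auto simp: wf_goal_def)
next
  case (ImpLI x A \<Gamma> B \<Omega>)
  then have "set \<Omega> \<subseteq> \<Gamma>"
    by - (rule subset_insert_fresh[of _ x A], auto)
  with ImpLI show ?case
    by (auto simp: wf_goal_def)
next
  case (OneE \<Gamma> m \<Omega>M C \<Omega>L \<Omega>R)
  then show ?case
    using octx_ge_trans[of \<Omega>M m "mode C"] by (auto simp: wf_goal_def)
next
  case (DownI \<Gamma> A \<Omega> m)
  then show ?case
    \<comment> \<open>Well-modedness of \<open>Down m A\<close> supplies
      \<open>mode A \<ge> m\<close>.\<close>
    using octx_ge_trans[of \<Omega> "mode A" m] by (auto simp: wf_goal_def)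
next
  case (UpE \<Gamma> l A \<Omega>)
  then show ?case
    \<comment> \<open>Well-modedness of \<open>Up l A\<close> supplies
      \<open>l \<ge> mode A\<close>.\<close>
    using octx_ge_trans[of \<Omega> l "mode A"] by (auto simp: wf_goal_def)
qed (auto simp: wf_goal_def)

text \<open>Yields the \<open>wf_sequent\<close> condition that sequent rules place on their
  conclusion: below, it is applied to the conclusion of the natural deduction rule being
  translated.\<close>

lemma natded_wf_sequent: "natded \<sigma> \<Gamma> C \<Omega> \<Longrightarrow> wf_sequent \<Omega> C"
  using natded_wf[of \<sigma> \<Gamma> C \<Omega>] wf_hyps_subset[of \<Gamma> "set \<Omega>"]
  by (auto simp: wf_sequent_def wf_goal_def)

text \<open>The shared pattern of all eliminations: \<open>A\<close> is the major proposition,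
  \<open>left\<close> the application of its left rule, and \<open>V\<close> the variables bound in
  the minor premises, which the principal variable of that left rule must avoid.\<close>

lemma cut_fresh:
  assumes "finite V" "sequent \<sigma> \<Omega>M A" "wf_sequent \<Omega>M A" "mode A \<ge> mode C"
    and "wf_sequent (\<Omega>L @ \<Omega>M @ \<Omega>R) C"
    and left: "\<And>z. z \<notin> V \<Longrightarrow> z \<notin> vars (\<Omega>L @ \<Omega>R) \<Longrightarrow> wf_sequent (\<Omega>L @ [(z, A)] @ \<Omega>R) C \<Longrightarrow>
      sequent \<sigma> (\<Omega>L @ [(z, A)] @ \<Omega>R) C"
  shows "sequent \<sigma> (\<Omega>L @ \<Omega>M @ \<Omega>R) C"
proof -
  \<comment> \<open>Besides \<open>V\<close>, the variable avoids \<open>\<Omega>M\<close> as well,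
    because the freshness condition of \<open>Cut\<close> covers its whole conclusion.\<close>
  obtain z where z: "z \<notin> V" "z \<notin> vars (\<Omega>L @ \<Omega>M @ \<Omega>R)"
    using ex_new_if_finite[of "V \<union> vars (\<Omega>L @ \<Omega>M @ \<Omega>R)"] \<open>finite V\<close> by auto
  have "wf_hyps (set (\<Omega>L @ \<Omega>R))"
    using assms(5) by - (rule wf_hyps_subset[of "set (\<Omega>L @ \<Omega>M @ \<Omega>R)"], auto simp: wf_sequent_def)
  then have "wf_sequent (\<Omega>L @ [(z, A)] @ \<Omega>R) C"
    using wf_hyps_insert_fresh[of "\<Omega>L @ \<Omega>R" z A] assms(3-5) z by (auto simp: wf_sequent_def)
  \<comment> \<open>The \<open>octx_ge\<close> premise of \<open>Cut\<close> is the mode part of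
    \<open>wf_sequent \<Omega>M A\<close>.\<close>
  then show ?thesis
    using assms z by - (rule sequent.Cut[where A = A and x = z], auto simp: wf_sequent_def)
qed

lemma sequent_id: "wf_prop A \<Longrightarrow> sequent \<sigma> [(x, A)] A"
  by (rule sequent.Id) (auto simp: wf_sequent_def wf_hyps_def single_valued_def)

lemma obtain_fresh:
  assumes "finite V"
  obtains y :: var where "y \<notin> V"
  using ex_new_if_finite[OF infinite_UNIV_nat assms] by blast

theorem theorem5:
  fixes \<sigma> :: "'m::preorder \<Rightarrow> structural set"
    and \<Gamma> :: "('a, 'm) hyp set"
    and A :: "('a, 'm) mprop"
    and \<Omega> :: "('a, 'm) octx"
  assumes \<sigma>_mono: "\<And>k m. k \<ge> m \<Longrightarrow> \<sigma> k \<supseteq> \<sigma> m"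
    and deriv: "natded \<sigma> \<Gamma> A \<Omega>"
  shows "sequent \<sigma> \<Omega> A"
  using deriv
proof induction
  case (Hyp x A \<Gamma>)
  then show ?case
    by (simp add: wf_goal_def sequent_id)
next
  case (OneI \<Gamma> m)
  show ?case by (rule sequent.OneR)
next
  case (OneE \<Gamma> m \<Omega>M C \<Omega>L \<Omega>R)
  show ?case
  proof (rule cut_fresh[OF finite.emptyI])
    show "wf_sequent (\<Omega>L @ \<Omega>M @ \<Omega>R) C"
      by (rule natded_wf_sequent[OF natded.OneE[OF OneE.hyps]])
  qed (use OneE in \<open>auto intro!: natded_wf_sequent intro: sequent.OneL[simplified]\<close>)
next
  case (FuseI \<Gamma> A \<Omega>L B \<Omega>R)
  show ?case
    by (rule sequent.FuseR[OF FuseI.IH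
          natded_wf_sequent[OF natded.FuseI[OF FuseI.hyps]]])
next
  case (FuseE \<Gamma> A B \<Omega>M C x y \<Omega>L \<Omega>R)
  show ?case
  \<comment> \<open>\<open>FuseL\<close> wants \<open>x\<close> and \<open>y\<close> fresh for a
    conclusion that contains the cut variable, so the latter must differ from both.\<close>
  proof (rule cut_fresh[of "{x, y}"])
    show "wf_sequent (\<Omega>L @ \<Omega>M @ \<Omega>R) C"
      by (rule natded_wf_sequent[OF natded.FuseE[OF FuseE.hyps]])
    show "sequent \<sigma> (\<Omega>L @ [(z, Fuse A B)] @ \<Omega>R) C"
      if "z \<notin> {x, y}" "wf_sequent (\<Omega>L @ [(z, Fuse A B)] @ \<Omega>R) C" for z
      using that FuseE by - (rule sequent.FuseL[where ?x1.0 = x and ?x2.0 = y], auto)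
  qed (use FuseE in \<open>auto intro: natded_wf_sequent\<close>)
next
  case (PlusI1 \<Gamma> A \<Omega> B)
  show ?case
    by (rule sequent.PlusR1[OF PlusI1.IH
          natded_wf_sequent[OF natded.PlusI1[OF PlusI1.hyps]]])
next
  case (PlusI2 \<Gamma> B \<Omega> A)
  show ?case
    by (rule sequent.PlusR2[OF PlusI2.IH
          natded_wf_sequent[OF natded.PlusI2[OF PlusI2.hyps]]])
next
  case (PlusE \<Gamma> A B \<Omega>M C x \<Omega>L \<Omega>R)
  show ?case
  proof (rule cut_fresh[of "{x}"])
    show "wf_sequent (\<Omega>L @ \<Omega>M @ \<Omega>R) C"
      by (rule natded_wf_sequent[OF natded.PlusE[OF PlusE.hyps]])
    show "sequent \<sigma> (\<Omega>L @ [(z, Plus A B)] @ \<Omega>R) C"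
      if "z \<notin> {x}" "wf_sequent (\<Omega>L @ [(z, Plus A B)] @ \<Omega>R) C" for z
      using that PlusE by - (rule sequent.PlusL[where y = x], auto)
  qed (use PlusE in \<open>auto intro: natded_wf_sequent\<close>)
next
  case (DownI \<Gamma> A \<Omega> m)
  show ?case
    \<comment> \<open>\<open>DownR\<close> asks for \<open>octx_ge \<Omega> (mode A)\<close>, which
      in natural deduction is an invariant of the premise.\<close>
    using natded_wf[OF DownI.hyps(1)]
    by - (rule sequent.DownR[OF DownI.IH _ natded_wf_sequent[OF natded.DownI[OF DownI.hyps]]], simp)
next
  case (DownE \<Gamma> m A \<Omega>M C x \<Omega>L \<Omega>R)
  show ?case
  proof (rule cut_fresh[of "{x}"])
    show "wf_sequent (\<Omega>L @ \<Omega>M @ \<Omega>R) C"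
      by (rule natded_wf_sequent[OF natded.DownE[OF DownE.hyps]])
    show "sequent \<sigma> (\<Omega>L @ [(z, Down m A)] @ \<Omega>R) C"
      if "z \<notin> {x}" "wf_sequent (\<Omega>L @ [(z, Down m A)] @ \<Omega>R) C" for z
      using that DownE by - (rule sequent.DownL[where y = x], auto)
  qed (use DownE in \<open>auto intro: natded_wf_sequent\<close>)
next
  case (ImpRI x A \<Gamma> B \<Omega>)
  show ?case
    by (rule sequent.ImpRR[OF ImpRI.IH ImpRI.hyps(2)
          natded_wf_sequent[OF natded.ImpRI[OF ImpRI.hyps]]])
next
  case (ImpRE \<Gamma> A B \<Omega>L \<Omega>R)
  have wf: "wf_sequent (\<Omega>L @ \<Omega>R) B" "wf_sequent \<Omega>L (ImpR A B)" "wf_sequent \<Omega>R A"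
    using natded_wf_sequent[OF natded.ImpRE[OF ImpRE.hyps]] ImpRE.hyps[THEN natded_wf_sequent] by simp_all
  \<comment> \<open>The function's context \<open>\<Omega>L\<close> is cut in to the left of the
    argument's context; the empty list is the left part around the cut.\<close>
  have "sequent \<sigma> ([] @ \<Omega>L @ \<Omega>R) B"
  proof (rule cut_fresh[OF finite.emptyI])
    fix z
    assume z: "wf_sequent ([] @ [(z, ImpR A B)] @ \<Omega>R) B"
    obtain y where "y \<notin> vars ([] @ [(z, ImpR A B)] @ \<Omega>R)"
      using obtain_fresh[OF finite_vars] .
    \<comment> \<open>\<open>ImpRL\<close> with argument context \<open>\<Omega>R\<close> and empty
      outer contexts; its remaining premise is the identity on \<open>y\<close> at
      \<open>B\<close>.\<close>
    then have "sequent \<sigma> ([] @ [(z, ImpR A B)] @ \<Omega>R @ []) B"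
      using wf z ImpRE.IH by - (rule sequent.ImpRL[where y = y], auto simp: wf_sequent_def sequent_id)
    then show "sequent \<sigma> ([] @ [(z, ImpR A B)] @ \<Omega>R) B" by simp
  qed (use wf ImpRE.IH in \<open>auto simp: wf_sequent_def\<close>)
  then show ?case by simp
next
  case (ImpLI x A \<Gamma> B \<Omega>)
  show ?case
    by (rule sequent.ImpLR[OF ImpLI.IH ImpLI.hyps(2)
          natded_wf_sequent[OF natded.ImpLI[OF ImpLI.hyps]]])
next
  case (ImpLE \<Gamma> A B \<Omega>R \<Omega>L)
  have wf: "wf_sequent (\<Omega>L @ \<Omega>R) B" "wf_sequent \<Omega>R (ImpL A B)" "wf_sequent \<Omega>L A"
    using natded_wf_sequent[OF natded.ImpLE[OF ImpLE.hyps]] ImpLE.hyps[THEN natded_wf_sequent] by simp_all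
  \<comment> \<open>Mirror image of \<open>ImpRE\<close>: the function's context
    \<open>\<Omega>R\<close> is cut in to the right of the argument's context
    \<open>\<Omega>L\<close>.\<close>
  have "sequent \<sigma> (\<Omega>L @ \<Omega>R @ []) B"
  proof (rule cut_fresh[OF finite.emptyI])
    fix z
    assume z: "wf_sequent (\<Omega>L @ [(z, ImpL A B)] @ []) B"
    obtain y where "y \<notin> vars (\<Omega>L @ [(z, ImpL A B)] @ [])"
      using obtain_fresh[OF finite_vars] .
    then have "sequent \<sigma> ([] @ \<Omega>L @ [(z, ImpL A B)] @ []) B"
      using wf z ImpLE.IH by - (rule sequent.ImpLL[where y = y], auto simp: wf_sequent_def sequent_id)
    then show "sequent \<sigma> (\<Omega>L @ [(z, ImpL A B)] @ []) B" by simp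
  qed (use wf ImpLE.IH in \<open>auto simp: wf_sequent_def\<close>)
  then show ?case by simp
next
  case (WithI \<Gamma> A \<Omega> B)
  show ?case
    by (rule sequent.WithR[OF WithI.IH
          natded_wf_sequent[OF natded.WithI[OF WithI.hyps]]])
next
  case (WithE1 \<Gamma> A B \<Omega>)
  have wf: "wf_sequent \<Omega> A" "wf_sequent \<Omega> (With A B)"
    using natded_wf_sequent[OF natded.WithE1[OF WithE1.hyps]] WithE1.hyps[THEN natded_wf_sequent] by simp_all
  have "sequent \<sigma> ([] @ \<Omega> @ []) A"
  proof (rule cut_fresh[OF finite.emptyI])
    fix z
    assume z: "wf_sequent ([] @ [(z, With A B)] @ []) A"
    show "sequent \<sigma> ([] @ [(z, With A B)] @ []) A"
      \<comment> \<open>\<open>Suc z\<close> is just some variable other than \<open>z\<close>, the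
        only one in the context; the premise is an identity.\<close>
      using wf z by - (rule sequent.WithL1[where y = "Suc z"], auto simp: wf_sequent_def sequent_id)
  qed (use wf WithE1.IH in \<open>auto simp: wf_sequent_def\<close>)
  then show ?case by simp
next
  case (WithE2 \<Gamma> A B \<Omega>)
  have wf: "wf_sequent \<Omega> B" "wf_sequent \<Omega> (With A B)"
    using natded_wf_sequent[OF natded.WithE2[OF WithE2.hyps]] WithE2.hyps[THEN natded_wf_sequent] by simp_all
  have "sequent \<sigma> ([] @ \<Omega> @ []) B"
  proof (rule cut_fresh[OF finite.emptyI])
    fix z
    assume z: "wf_sequent ([] @ [(z, With A B)] @ []) B"
    show "sequent \<sigma> ([] @ [(z, With A B)] @ []) B"
      using wf z by - (rule sequent.WithL2[where y = "Suc z"], auto simp: wf_sequent_def sequent_id)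
  \<comment> \<open>The mode condition of the cut compares \<open>mode (With A B)\<close>, defined
    as \<open>mode A\<close>, with \<open>mode B\<close>; well-modedness equates the two.\<close>
  qed (use wf WithE2.IH in \<open>auto simp: wf_sequent_def\<close>)
  then show ?case by simp
next
  case (UpI \<Gamma> A \<Omega> m)
  show ?case
    \<comment> \<open>The condition \<open>octx_ge \<Omega> m\<close> of \<open>UpI\<close> turns
      into the presupposition of the sequent for \<open>Up m A\<close>.\<close>
    by (rule sequent.UpR[OF UpI.IH
          natded_wf_sequent[OF natded.UpI[OF UpI.hyps]]])
next
  case (UpE \<Gamma> l A \<Omega>)
  have wf: "wf_sequent \<Omega> A" "wf_sequent \<Omega> (Up l A)"
    using natded_wf_sequent[OF natded.UpE[OF UpE.hyps]] UpE.hyps[THEN natded_wf_sequent] by simp_all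
  have "sequent \<sigma> ([] @ \<Omega> @ []) A"
  proof (rule cut_fresh[OF finite.emptyI])
    fix z
    assume z: "wf_sequent ([] @ [(z, Up l A)] @ []) A"
    show "sequent \<sigma> ([] @ [(z, Up l A)] @ []) A"
      using wf z by - (rule sequent.UpL[where y = "Suc z"], auto simp: wf_sequent_def sequent_id)
  \<comment> \<open>The mode condition of the cut, \<open>l \<ge> mode A\<close>, is part of
    \<open>wf_prop (Up l A)\<close>.\<close>
  qed (use wf UpE.IH in \<open>auto simp: wf_sequent_def\<close>)
  then show ?case by simp
next
  case (NWeak \<Gamma> C \<Omega>L \<Omega>R x A)
  show ?case
    \<comment> \<open>The membership in \<open>\<Gamma>\<close> and the mode bound of
      \<open>NWeak\<close> make the enlarged context satisfy the presupposition.\<close>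
    by (rule sequent.Weak[OF NWeak.IH NWeak.hyps(4)
          natded_wf_sequent[OF natded.NWeak[OF NWeak.hyps]]])
next
  case (NContrR \<Gamma> C \<Omega>L x A \<Omega>M \<Omega>R)
  show ?case
    by (rule sequent.ContrR[OF NContrR.IH NContrR.hyps(2)
          natded_wf_sequent[OF natded.NContrR[OF NContrR.hyps]]])
next
  case (NContrL \<Gamma> C \<Omega>L x A \<Omega>M \<Omega>R)
  show ?case
    by (rule sequent.ContrL[OF NContrL.IH NContrL.hyps(2)
          natded_wf_sequent[OF natded.NContrL[OF NContrL.hyps]]])
next
  case (NMobR \<Gamma> C \<Omega>L x A \<Omega>M \<Omega>R)
  show ?case
    by (rule sequent.MobR[OF NMobR.IH NMobR.hyps(2)
          natded_wf_sequent[OF natded.NMobR[OF NMobR.hyps]]])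
next
  case (NMobL \<Gamma> C \<Omega>L \<Omega>M x A \<Omega>R)
  show ?case
    by (rule sequent.MobL[OF NMobL.IH NMobL.hyps(2)
          natded_wf_sequent[OF natded.NMobL[OF NMobL.hyps]]])
qed

end
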